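(* For every integer $k\geq 4$ there exists a measurable $k$-coloring $f$ of the real line with the following property: there is no finite family $F$ of closed intervals of positive length, whose members have pairwise disjoint interiors and which have at most $k-1$ endpoints in total, such that $F$ has a fair partition into $q$ parts (with respect to $f$) for some integer $q\geq 2$.
   Context: A measurable $k$-coloring of $\mathbb{R}$ is a map $f:\mathbb{R}\to\{1,\ldots,k\}$ such that each $f^{-1}(i)$ is Lebesgue measurable. For a family $F$ of closed intervals with pairwise disjoint interiors and an integer $q\ge2$, a fair partition of $F$ into $q$ parts is a partition $F=F_1\cup\cdots\cup F_q$ into $q$ disjoint subcollections such that for every color $i$ and every $j\in\{1,\ldots,q\}$, the Lebesgue measure of $f^{-1}(i)$ in the union of the members of $F_j$ equals exactly $1/q$ of the Lebesgue measure of $f^{-1}(i)$ in the union of all members of $F$. *)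

theory Defs
  imports "HOL-Analysis.Analysis"
begin

definition measurable_coloring :: "nat \<Rightarrow> (real \<Rightarrow> nat) \<Rightarrow> bool" where
  "measurable_coloring k f \<longleftrightarrow>
     (\<forall>x. f x \<in> {1..k}) \<and> (\<forall>i\<in>{1..k}. f -` {i} \<in> sets lebesgue)"

definition interval_family :: "real set set \<Rightarrow> bool" where
  "interval_family F \<longleftrightarrow>
     finite F \<and>
     (\<forall>I\<in>F. \<exists>a b. a < b \<and> I = {a..b}) \<and>
     pairwise (\<lambda>I J. interior I \<inter> interior J = {}) F"

text \<open>Endpoints are counted as points of the line: a point where two members of the family
  abut is one endpoint.\<close>

definition endpoints :: "real set set \<Rightarrow> real set" where
  "endpoints F = {x. \<exists>a b. a < b \<and> {a..b} \<in> F \<and> (x = a \<or> x = b)}"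

text \<open>Parts are allowed to be empty. All the sets measured are bounded when \<open>F\<close> is a finite family
  of compact intervals, so the real-valued measure is the genuine Lebesgue measure.\<close>

definition fair_partition ::
  "nat \<Rightarrow> (real \<Rightarrow> nat) \<Rightarrow> real set set \<Rightarrow> nat \<Rightarrow> (nat \<Rightarrow> real set set) \<Rightarrow> bool" where
  "fair_partition k f F q P \<longleftrightarrow>
     (\<Union>j\<in>{1..q}. P j) = F \<and>
     disjoint_family_on P {1..q} \<and>
     (\<forall>i\<in>{1..k}. \<forall>j\<in>{1..q}.
        measure lebesgue (f -` {i} \<inter> \<Union>(P j)) =
          1 / real q * measure lebesgue (f -` {i} \<inter> \<Union>F))"

end

theory Submission
  imports Defs
begin

text \<open>
  Put \<open>M = k + 2\<close> and let the grid of stage \<open>n\<close> have width \<open>1 / res n\<close>. To pass from stage \<open>n\<close> to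
  stage \<open>n + 1\<close>, number the grid cells in \<open>[-(n+1), n+1)\<close> by \<open>r = 0, 1, \<dots>\<close>, refine the grid, and
  recolour an initial part of cell \<open>r\<close> by \<open>k\<close> consecutive blocks of \<open>M ^ r\<close> fine cells, one for each
  colour. The refinement is by a power of \<open>M\<close> so large that the recoloured set is tiny compared with
  the old grid width, so the stages converge almost everywhere.

  Suppose two disjoint subfamilies of \<open>F\<close>, not both empty, had equal measure in every colour. There
  are fewer than \<open>k\<close> endpoints, so at any stage some colour \<open>i\<close> contains none of them, and each block
  of colour \<open>i\<close> lies inside or outside each of the two unions. At a late stage the difference of
  their measures in colour \<open>i\<close>, in units of the fine grid width, is then
  \<open>\<Sum>r. \<sigma> r * M ^ r + \<tau> r * (W - k * M ^ r)\<close> with \<open>\<sigma> r, \<tau> r \<in> {-1, 0, 1}\<close> and \<open>W\<close> divisible by a high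
  power of \<open>M\<close>. Read in base \<open>M\<close>, this integer is nonzero as soon as some \<open>\<sigma> r\<close> is, which holds once a
  member of one subfamily contains a whole cell. So the difference is at least one fine grid width,
  more than all later stages can compensate.
\<close>

section \<open>Signed digit expansions in base \<open>k + 2\<close>\<close>

text \<open>Modulo \<open>M\<close> the sum reduces to \<open>c 0\<close>, and a multiple of
  \<open>M\<close> of absolute value below \<open>M\<close> is zero. Dividing by \<open>M\<close>
  leaves the shifted digits. Divisibility by \<open>M ^ R\<close> is assumed instead of vanishing so
  that multiples of the refinement ratio can be absorbed.\<close>

lemma signed_digits_zero:
  fixes c :: "nat \<Rightarrow> int" and M :: int
  assumes "\<And>r. \<bar>c r\<bar> < M" and "M ^ R dvd (\<Sum>r<R. c r * M ^ r)" and "r < R"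
  shows "c r = 0"
  using assms
proof (induction R arbitrary: c r)
  case 0
  then show ?case by simp
next
  case (Suc R)
  have M: "M > 0" using Suc.prems(1)[of 0] by linarith
  have eq: "(\<Sum>r<Suc R. c r * M ^ r) = c 0 + M * (\<Sum>r<R. c (Suc r) * M ^ r)"
    by (simp only: sum.lessThan_Suc_shift) (simp add: sum_distrib_left algebra_simps)
  have "M dvd c 0 + M * (\<Sum>r<R. c (Suc r) * M ^ r)"
    using Suc.prems(2) unfolding eq by (metis dvd_mult_left power_Suc)
  then have "M dvd c 0" by (simp add: dvd_add_left_iff)
  then have c0: "c 0 = 0"
    using Suc.prems(1)[of 0] by (metis abs_of_pos M dvd_imp_le_int linorder_not_less)
  have "M ^ R dvd (\<Sum>r<R. c (Suc r) * M ^ r)"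
    using Suc.prems(2) M unfolding eq c0 by simp
  then have "c (Suc r') = 0" if "r' < R" for r'
    using Suc.IH[of "\<lambda>r. c (Suc r)"] Suc.prems(1) that by blast
  then show ?case using c0 Suc.prems(3) by (cases r) auto
qed

text \<open>Up to a multiple of \<open>W\<close> the sum has the digits
  \<open>\<sigma> r - k * \<tau> r\<close>, of absolute value at most \<open>k + 1\<close>; hence
  the base \<open>k + 2\<close>. If the sum vanished, so would every digit, but
  \<open>\<sigma> r = k * \<tau> r\<close> with \<open>\<bar>\<sigma> r\<bar> \<le> 1\<close> and
  \<open>k \<ge> 2\<close> forces \<open>\<sigma> r = 0\<close>.\<close>

lemma block_sum_nonzero:
  fixes \<sigma> \<tau> :: "nat \<Rightarrow> int" and k :: int
  assumes k: "k \<ge> 2"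
    and \<sigma>: "\<And>r. \<bar>\<sigma> r\<bar> \<le> 1" and \<tau>: "\<And>r. \<bar>\<tau> r\<bar> \<le> 1"
    and W: "(k + 2) ^ R dvd W"
    and r: "r < R" "\<sigma> r \<noteq> 0"
  shows "(\<Sum>r<R. \<sigma> r * (k + 2) ^ r + \<tau> r * (W - k * (k + 2) ^ r)) \<noteq> 0"
proof
  assume "(\<Sum>r<R. \<sigma> r * (k + 2) ^ r + \<tau> r * (W - k * (k + 2) ^ r)) = 0"
  moreover have "(\<Sum>r<R. \<sigma> r * (k + 2) ^ r + \<tau> r * (W - k * (k + 2) ^ r)) =
      (\<Sum>r<R. (\<sigma> r - k * \<tau> r) * (k + 2) ^ r) + W * (\<Sum>r<R. \<tau> r)"
    by (simp add: sum_distrib_left flip: sum.distrib) (simp add: algebra_simps)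
  ultimately have "(\<Sum>r<R. (\<sigma> r - k * \<tau> r) * (k + 2) ^ r) = W * - (\<Sum>r<R. \<tau> r)" by simp
  then have "(k + 2) ^ R dvd (\<Sum>r<R. (\<sigma> r - k * \<tau> r) * (k + 2) ^ r)"
    using dvd_mult2[OF W] by simp
  moreover have "\<bar>\<sigma> r - k * \<tau> r\<bar> < k + 2" for r
  proof -
    have "\<bar>k * \<tau> r\<bar> \<le> k * 1" unfolding abs_mult using k \<tau>[of r] by (intro mult_mono) auto
    then show ?thesis using \<sigma>[of r] by linarith
  qed
  ultimately have "\<sigma> r = k * \<tau> r"
    using signed_digits_zero[of "\<lambda>r. \<sigma> r - k * \<tau> r" "k + 2" R r] r(1) by auto
  moreover have "\<tau> r = -1 \<or> \<tau> r = 0 \<or> \<tau> r = 1" using \<tau>[of r] by linarith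
  ultimately show False using r(2) \<sigma>[of r] k by auto
qed

section \<open>Unions of intervals on stretches free of endpoints\<close>

text \<open>A closed interval containing one point of the stretch and missing another has an
  endpoint in the stretch.\<close>

lemma union_intervals_saturated:
  assumes "interval_family F" and "A \<subseteq> F" and Y: "{a..<b} \<inter> endpoints F = {}"
  shows "{a..<b} \<subseteq> \<Union>A \<or> {a..<b} \<inter> \<Union>A = {}"
proof (rule ccontr)
  assume "\<not> ?thesis"
  then obtain x y where xy: "x \<in> {a..<b}" "x \<in> \<Union>A" "y \<in> {a..<b}" "y \<notin> \<Union>A" by blast
  then obtain I where I: "I \<in> A" "x \<in> I" "y \<notin> I" by blast
  then obtain p q where pq: "p < q" "I = {p..q}"
    using assms(1,2) unfolding interval_family_def by blast
  then have "p \<in> endpoints F" "q \<in> endpoints F"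
    using I assms(2) unfolding endpoints_def by blast+
  then have "p \<notin> {a..<b}" "q \<notin> {a..<b}" using Y by blast+
  then show False using xy I pq by auto
qed

lemma finite_endpoints:
  assumes "interval_family F"
  shows "finite (endpoints F)"
proof (rule finite_subset)
  show "endpoints F \<subseteq> Inf ` F \<union> Sup ` F"
  proof
    fix x assume "x \<in> endpoints F"
    then obtain a b where ab: "a < b" "{a..b} \<in> F" "x = a \<or> x = b" unfolding endpoints_def by blast
    then have "Inf {a..b} = a" "Sup {a..b} = b" by auto
    then show "x \<in> Inf ` F \<union> Sup ` F" using ab by (metis UnI1 UnI2 imageI)
  qed
  show "finite (Inf ` F \<union> Sup ` F)" using assms unfolding interval_family_def by auto
qed

text \<open>Otherwise the members of \<open>A\<close> and \<open>B\<close> through \<open>a\<close>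
  would each contain the whole stretch, and their interiors would share its midpoint.\<close>

lemma union_intervals_not_both:
  assumes F: "interval_family F" and "A \<subseteq> F" "B \<subseteq> F" "A \<inter> B = {}"
    and "a < b" and Y: "{a..<b} \<inter> endpoints F = {}"
  shows "\<not> ({a..<b} \<subseteq> \<Union>A \<and> {a..<b} \<subseteq> \<Union>B)"
proof
  assume sub: "{a..<b} \<subseteq> \<Union>A \<and> {a..<b} \<subseteq> \<Union>B"
  have a: "a \<in> {a..<b}" using \<open>a < b\<close> by auto
  obtain I J where IJ: "I \<in> A" "J \<in> B" "a \<in> I" "a \<in> J" using sub a by blast
  \<comment> \<open>Saturation applied to the one-member subfamily \<open>{K}\<close>.\<close>
  have "{a..<b} \<subseteq> K" if "K \<in> F" "a \<in> K" for K
    using union_intervals_saturated[OF F, of "{K}" a b] that Y a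
    unfolding Sup_insert by blast
  then have "{a..<b} \<subseteq> I" "{a..<b} \<subseteq> J" using IJ assms(2,3) by blast+
  then have "{a<..<b} \<subseteq> I" "{a<..<b} \<subseteq> J" by (auto dest: subsetD)
  then have "{a<..<b} \<subseteq> interior I \<inter> interior J" by (simp add: interior_maximal)
  moreover have "I \<in> F" "J \<in> F" "I \<noteq> J" using IJ assms(2-4) by blast+
  then have "interior I \<inter> interior J = {}"
    using F unfolding interval_family_def by (meson pairwiseD)
  moreover have "(a + b) / 2 \<in> {a<..<b}" using \<open>a < b\<close> by simp
  ultimately show False by blast
qed

section \<open>Construction of the stages and of the limit colouring\<close>

locale multiscale_coloring =
  fixes k :: nat
  assumes k: "k \<ge> 4"
begin

text \<open>\<open>cells n\<close> counts the stage \<open>n\<close> grid cells in \<open>[-(n+1), n+1)\<close>. The exponent in \<open>ratio n\<close> exceeds all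
  indices \<open>r < cells n\<close>, and by one more than needed for divisibility so that the blocks are small.\<close>

primrec res :: "nat \<Rightarrow> nat" where
  "res 0 = 1"
| "res (Suc n) = res n * (k + 2) ^ (2 * Suc n * res n + 1)"

definition cells :: "nat \<Rightarrow> nat" where "cells n = 2 * Suc n * res n"

definition ratio :: "nat \<Rightarrow> nat" where "ratio n = (k + 2) ^ (cells n + 1)"

lemma res_Suc: "res (Suc n) = res n * ratio n"
  by (simp add: ratio_def cells_def)

lemma res_pos: "res n > 0" by (induction n) auto

declare res.simps(2) [simp del]

lemma ratio_pos: "ratio n > 0" by (simp add: ratio_def)

text \<open>\<open>col n v\<close> is the stage \<open>n\<close> colour of the cell \<open>[v / res n, (v + 1) / res n)\<close>; colours are counted
  from \<open>0\<close>.\<close>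

primrec col :: "nat \<Rightarrow> int \<Rightarrow> nat" where
  "col 0 v = 0"
| "col (Suc n) v =
    (let t = v div int (ratio n); u = v mod int (ratio n); r = t + int (Suc n * res n)
     in if 0 \<le> r \<and> r < int (cells n) \<and> u < int k * (int k + 2) ^ nat r
        then nat (u div (int k + 2) ^ nat r) else col n t)"

definition stage :: "nat \<Rightarrow> real \<Rightarrow> nat" where "stage n x = col n \<lfloor>x * real (res n)\<rfloor>"

text \<open>Half-open, so that cells tile the line and membership is a condition on a floor.\<close>

definition grid_ivl :: "nat \<Rightarrow> int \<Rightarrow> int \<Rightarrow> real set" where
  "grid_ivl n a b = {real_of_int a / real (res n)..<real_of_int b / real (res n)}"

text \<open>The shift makes the cell starting at \<open>-(n+1)\<close> the one with number
  \<open>0\<close>.\<close>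

definition idx :: "nat \<Rightarrow> nat \<Rightarrow> int" where "idx n r = int r - int (Suc n * res n)"

text \<open>The set recoloured in passing from stage \<open>n\<close> to stage
  \<open>n + 1\<close>.\<close>

definition zone :: "nat \<Rightarrow> real set" where
  "zone n = (\<Union>r<cells n. grid_ivl (Suc n) (idx n r * int (ratio n)) (idx n r * int (ratio n) + int k * (int k + 2) ^ r))"

text \<open>A pointwise limes inferior: total, measurable, and equal to the limit wherever the stages
  stabilise.\<close>

definition limcol :: "real \<Rightarrow> nat" where
  "limcol x = (LEAST c. \<forall>m. \<exists>n\<ge>m. stage n x \<le> c)"

section \<open>Grid arithmetic and the recolouring of a single cell\<close>

lemma mem_grid_ivl: "x \<in> grid_ivl n a b \<longleftrightarrow> a \<le> \<lfloor>x * real (res n)\<rfloor> \<and> \<lfloor>x * real (res n)\<rfloor> < b"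
  using res_pos[of n] unfolding grid_ivl_def by (simp add: field_simps le_floor_iff floor_less_iff)

lemma measure_grid_ivl: "a \<le> b \<Longrightarrow> measure lebesgue (grid_ivl n a b) = real_of_int (b - a) / real (res n)"
  using res_pos[of n] unfolding grid_ivl_def by (simp add: divide_right_mono diff_divide_distrib)

lemma grid_ivl_lmeasurable: "grid_ivl n a b \<in> lmeasurable"
  unfolding grid_ivl_def by (rule bounded_set_imp_lmeasurable) auto

lemma floor_res_Suc: "\<lfloor>x * real (res (Suc n))\<rfloor> div int (ratio n) = \<lfloor>x * real (res n)\<rfloor>"
proof -
  have "x * real (res n) = x * real (res (Suc n)) / real_of_int (int (ratio n))"
    using ratio_pos[of n] by (simp add: res_Suc)
  then show ?thesis by (metis floor_divide_real_eq_div of_nat_0_le_iff)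
qed

lemma blocks_fit: "r < cells n \<Longrightarrow> int k * (int k + 2) ^ r < int (ratio n)"
proof -
  assume "r < cells n"
  have "k * (k + 2) ^ r < (k + 2) ^ Suc r" by simp
  also have "\<dots> \<le> ratio n" unfolding ratio_def using \<open>r < cells n\<close> by (intro power_increasing) auto
  finally have "int (k * (k + 2) ^ r) < int (ratio n)" by (simp only: of_nat_less_iff)
  then show ?thesis by (simp only: of_nat_mult of_nat_power of_nat_add of_nat_numeral)
qed

lemma col_Suc:
  assumes "r < cells n" "0 \<le> u" "u < int (ratio n)"
  shows "col (Suc n) (idx n r * int (ratio n) + u) =
    (if u < int k * (int k + 2) ^ r then nat (u div (int k + 2) ^ r) else col n (idx n r))"
proof -
  have "(idx n r * int (ratio n) + u) div int (ratio n) = idx n r" "(idx n r * int (ratio n) + u) mod int (ratio n) = u"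
    using assms by auto
  then show ?thesis using assms(1) by (simp add: Let_def idx_def)
qed

lemma cell_eq: "grid_ivl n t (t + 1) = grid_ivl (Suc n) (t * int (ratio n)) (t * int (ratio n) + int (ratio n))"
proof -
  have "real_of_int t / real (res n) = real_of_int (t * int (ratio n)) / real (res (Suc n))" for t
    using ratio_pos[of n] by (simp add: res_Suc)
  from this[of t] this[of "t + 1"] show ?thesis unfolding grid_ivl_def by (simp add: algebra_simps)
qed

lemma stage_less: "stage n x < k"
proof -
  have "col n v < k" for v
  proof (induction n arbitrary: v)
    case 0 then show ?case using k by simp
  next
    case (Suc n)
    have "0 \<le> v mod int (ratio n)" using ratio_pos[of n] by simp
    moreover have "nat (u div (int k + 2) ^ r) < k" if "0 \<le> u" "u < int k * (int k + 2) ^ r" for u r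
    proof -
      have "(int k + 2) ^ r * (u div (int k + 2) ^ r) \<le> u"
        using pos_mod_sign[of "(int k + 2) ^ r" u] mult_div_mod_eq[of "(int k + 2) ^ r" u]
          zero_less_power[of "int k + 2" r] by linarith
      then have "(int k + 2) ^ r * (u div (int k + 2) ^ r) < (int k + 2) ^ r * int k"
        using that(2) by (metis le_less_trans mult.commute)
      then have "u div (int k + 2) ^ r < int k" by (rule mult_left_less_imp_less) simp
      then show ?thesis using k by (simp add: nat_less_iff)
    qed
    ultimately show ?case using Suc by (simp add: Let_def)
  qed
  then show ?thesis unfolding stage_def .
qed

text \<open>Colour \<open>i\<close> fills its own new block and, if it was the old colour of the
  cell, also the part behind all \<open>k\<close> blocks.\<close>

lemma stage_on_cell:
  assumes "r < cells n" "i < k"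
  defines "t \<equiv> idx n r"
  shows "grid_ivl n t (t + 1) \<inter> stage (Suc n) -` {i} =
    grid_ivl (Suc n) (t * int (ratio n) + int i * (int k + 2) ^ r) (t * int (ratio n) + (int i + 1) * (int k + 2) ^ r) \<union>
    (if col n t = i
     then grid_ivl (Suc n) (t * int (ratio n) + int k * (int k + 2) ^ r) (t * int (ratio n) + int (ratio n))
     else {})"
    (is "?L = ?A \<union> ?B")
proof (rule set_eqI)
  fix x
  \<comment> \<open>The offset of the fine cell of \<open>x\<close> inside the coarse cell; every
    membership below becomes an inequality for \<open>u\<close>.\<close>
  define u where "u = \<lfloor>x * real (res (Suc n))\<rfloor> - t * int (ratio n)"
  let ?p = "(int k + 2) ^ r"
  have p: "?p > 0" by simp
  have fl: "\<lfloor>x * real (res (Suc n))\<rfloor> = t * int (ratio n) + u" by (simp add: u_def)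
  have L: "x \<in> ?L \<longleftrightarrow> 0 \<le> u \<and> u < int (ratio n) \<and> col (Suc n) (t * int (ratio n) + u) = i"
    unfolding cell_eq Int_iff mem_grid_ivl stage_def vimage_singleton_eq fl by auto
  have A: "x \<in> ?A \<longleftrightarrow> int i * ?p \<le> u \<and> u < (int i + 1) * ?p"
    unfolding mem_grid_ivl fl by auto
  have B: "x \<in> ?B \<longleftrightarrow> col n t = i \<and> int k * ?p \<le> u \<and> u < int (ratio n)"
    by (auto simp: mem_grid_ivl fl)
  have ik: "(int i + 1) * ?p \<le> int k * ?p" using assms(2) by (intro mult_right_mono) auto
  have kW: "int k * ?p < int (ratio n)" by (rule blocks_fit[OF assms(1)])
  have i0: "0 \<le> int i * ?p" "0 \<le> int k * ?p" by simp_all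
  have d: "nat (u div ?p) = i \<longleftrightarrow> int i * ?p \<le> u \<and> u < (int i + 1) * ?p" if "0 \<le> u"
  proof -
    have "nat (u div ?p) = i \<longleftrightarrow> u div ?p = int i" using that p by (auto simp: pos_imp_zdiv_nonneg_iff)
    also have "\<dots> \<longleftrightarrow> int i * ?p \<le> u \<and> u < (int i + 1) * ?p"
    proof
      assume "u div ?p = int i"
      then have "u = int i * ?p + u mod ?p" by (metis div_mult_mod_eq)
      then show "int i * ?p \<le> u \<and> u < (int i + 1) * ?p"
        using pos_mod_bound[OF p, of u] pos_mod_sign[OF p, of u] unfolding distrib_right by linarith
    next
      assume "int i * ?p \<le> u \<and> u < (int i + 1) * ?p"
      then show "u div ?p = int i"
        by (intro int_div_pos_eq[of _ _ _ "u - int i * ?p"]) (auto simp: distrib_right)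
    qed
    finally show ?thesis .
  qed
  show "x \<in> ?L \<longleftrightarrow> x \<in> ?A \<union> ?B"
  proof (cases "0 \<le> u \<and> u < int (ratio n)")
    case True
    then have c: "col (Suc n) (t * int (ratio n) + u) =
        (if u < int k * ?p then nat (u div ?p) else col n t)"
      unfolding t_def using col_Suc[OF assms(1)] by blast
    show ?thesis
    proof (cases "u < int k * ?p")
      case u: True
      then show ?thesis unfolding Un_iff L A B c using True d by simp
    next
      case u: False
      then have "\<not> u < (int i + 1) * ?p" using ik by linarith
      then show ?thesis unfolding Un_iff L A B c using True u by auto
    qed
  next
    case False
    then show ?thesis unfolding Un_iff L A B using i0 ik kW by linarith
  qed
qed


abbreviation block :: "nat \<Rightarrow> nat \<Rightarrow> nat \<Rightarrow> real set" where
  "block n r i \<equiv> grid_ivl (Suc n) (idx n r * int (ratio n) + int i * (int k + 2) ^ r)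
     (idx n r * int (ratio n) + (int i + 1) * (int k + 2) ^ r)"

text \<open>The end of cell \<open>r\<close>, which keeps its old colour.\<close>

abbreviation rest :: "nat \<Rightarrow> nat \<Rightarrow> real set" where
  "rest n r \<equiv> grid_ivl (Suc n) (idx n r * int (ratio n) + int k * (int k + 2) ^ r)
     (idx n r * int (ratio n) + int (ratio n))"

section \<open>Measures of colour classes at a finite stage\<close>

text \<open>The first assumption is the conclusion of \<open>union_intervals_saturated\<close>, with
  \<open>Y\<close> the endpoints and \<open>U\<close> the union of a subfamily.\<close>

lemma measure_grid_ivl_Int:
  assumes "\<And>a b. {a..<b} \<inter> Y = {} \<Longrightarrow> {a..<b} \<subseteq> U \<or> {a..<b} \<inter> U = {}"
    and "grid_ivl n a b \<inter> Y = {}" and "a < b"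
  shows "measure lebesgue (grid_ivl n a b \<inter> U) =
    of_bool (grid_ivl n a b \<subseteq> U) * real_of_int (b - a) / real (res n)"
proof (cases "grid_ivl n a b \<subseteq> U")
  case True
  then have "grid_ivl n a b \<inter> U = grid_ivl n a b" by blast
  then show ?thesis using True measure_grid_ivl[of a b n] assms(3) by simp
next
  case False
  then have "grid_ivl n a b \<inter> U = {}" using assms(1,2) unfolding grid_ivl_def by blast
  then show ?thesis using False by simp
qed

lemma measure_cell:
  assumes sat: "\<And>a b. {a..<b} \<inter> Y = {} \<Longrightarrow> {a..<b} \<subseteq> U \<or> {a..<b} \<inter> U = {}"
    and U: "U \<in> sets lebesgue" and i: "i < k" "i \<notin> stage (Suc n) ` Y" and r: "r < cells n"
  shows "measure lebesgue (grid_ivl n (idx n r) (idx n r + 1) \<inter> stage (Suc n) -` {i} \<inter> U) =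
    real_of_int (of_bool (block n r i \<subseteq> U) * (int k + 2) ^ r +
      of_bool (col n (idx n r) = i \<and> rest n r \<subseteq> U) * (int (ratio n) - int k * (int k + 2) ^ r)) /
      real (res (Suc n))"
proof -
  define B where "B = (if col n (idx n r) = i then rest n r else {})"
  have cell: "grid_ivl n (idx n r) (idx n r + 1) \<inter> stage (Suc n) -` {i} = block n r i \<union> B"
    unfolding B_def by (rule stage_on_cell[OF r i(1)])
  \<comment> \<open>Both pieces have colour \<open>i\<close>, which no point of \<open>Y\<close>
    has, so each lies inside or outside \<open>U\<close>.\<close>
  then have Y: "block n r i \<inter> Y = {}" "B \<inter> Y = {}" using i(2) by (blast dest: equalityD2)+
  have p: "(int k + 2) ^ r > 0" by simp
  have kW: "int k * (int k + 2) ^ r < int (ratio n)" by (rule blocks_fit[OF r])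
  have A': "measure lebesgue (block n r i \<inter> U) =
      real_of_int (of_bool (block n r i \<subseteq> U) * (int k + 2) ^ r) / real (res (Suc n))"
    using measure_grid_ivl_Int[OF sat Y(1)] p by (simp add: algebra_simps)
  have B': "measure lebesgue (B \<inter> U) =
      real_of_int (of_bool (col n (idx n r) = i \<and> rest n r \<subseteq> U) * (int (ratio n) - int k * (int k + 2) ^ r)) /
      real (res (Suc n))"
  proof (cases "col n (idx n r) = i")
    case True
    then have "rest n r \<inter> Y = {}" using Y(2) B_def by simp
    from measure_grid_ivl_Int[OF sat this] show ?thesis using kW True by (simp add: B_def)
  qed (simp add: B_def)
  have ik: "(int i + 1) * (int k + 2) ^ r \<le> int k * (int k + 2) ^ r"
    using i by (intro mult_right_mono) auto
  have disj: "block n r i \<inter> B = {}"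
  proof -
    have "x \<notin> rest n r" if "x \<in> block n r i" for x using that ik unfolding mem_grid_ivl by linarith
    then show ?thesis unfolding B_def by auto
  qed
  have fm: "block n r i \<inter> U \<in> lmeasurable" "B \<inter> U \<in> lmeasurable"
    using U grid_ivl_lmeasurable by (auto simp: B_def intro: fmeasurable_Int_fmeasurable)
  have "measure lebesgue ((block n r i \<inter> U) \<union> (B \<inter> U)) =
      measure lebesgue (block n r i \<inter> U) + measure lebesgue (B \<inter> U)"
  proof -
    have "(block n r i \<inter> U) \<inter> (B \<inter> U) = {}" using disj by blast
    then show ?thesis by (simp only: measure_Un3[OF fm] measure_empty diff_zero)
  qed
  then show ?thesis unfolding cell Int_Un_distrib2 A' B' by (simp add: add_divide_distrib)
qed

lemma stage_measurable [measurable]: "stage n \<in> borel \<rightarrow>\<^sub>M count_space UNIV"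
  unfolding stage_def by measurable

lemma limcol_measurable [measurable]: "limcol \<in> borel \<rightarrow>\<^sub>M count_space UNIV"
  unfolding limcol_def by measurable

lemma stage_vimage: "stage n -` {i} \<in> sets lebesgue"
  using measurable_sets[OF stage_measurable[of n], of "{i}"] by simp

lemma limcol_vimage: "limcol -` {i} \<in> sets lebesgue"
  using measurable_sets[OF limcol_measurable, of "{i}"] by simp

lemma idx_bounds: "r < cells n \<longleftrightarrow> - int (Suc n * res n) \<le> idx n r \<and> idx n r < int (Suc n * res n)"
proof -
  have "r < cells n \<longleftrightarrow> int r < 2 * int (Suc n * res n)"
    unfolding cells_def by (metis mult.assoc of_nat_less_iff of_nat_mult of_nat_numeral)
  then show ?thesis unfolding idx_def by linarith
qed

lemma cells_cover:
  "{- real (Suc n)..<real (Suc n)} = (\<Union>r<cells n. grid_ivl n (idx n r) (idx n r + 1))"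
proof (rule set_eqI)
  fix x :: real
  let ?v = "\<lfloor>x * real (res n)\<rfloor>"
  have "grid_ivl n (- int (Suc n * res n)) (int (Suc n * res n)) = {- real (Suc n)..<real (Suc n)}"
    using res_pos[of n] unfolding grid_ivl_def of_int_minus of_int_of_nat_eq of_nat_mult by simp
  then have "x \<in> {- real (Suc n)..<real (Suc n)} \<longleftrightarrow> - int (Suc n * res n) \<le> ?v \<and> ?v < int (Suc n * res n)"
    using mem_grid_ivl by metis
  also have "\<dots> \<longleftrightarrow> (\<exists>r. r < cells n \<and> ?v = idx n r)"
  proof
    assume v: "- int (Suc n * res n) \<le> ?v \<and> ?v < int (Suc n * res n)"
    then have "?v = idx n (nat (?v + int (Suc n * res n)))" unfolding idx_def by simp
    then show "\<exists>r. r < cells n \<and> ?v = idx n r" using idx_bounds v by metis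
  qed (use idx_bounds in metis)
  also have "\<dots> \<longleftrightarrow> x \<in> (\<Union>r<cells n. grid_ivl n (idx n r) (idx n r + 1))"
    by (auto simp: mem_grid_ivl)
  finally show "x \<in> {- real (Suc n)..<real (Suc n)} \<longleftrightarrow> x \<in> (\<Union>r<cells n. grid_ivl n (idx n r) (idx n r + 1))" .
qed

text \<open>The window containing \<open>U\<close> is tiled by the numbered cells, so the cell
  contributions add up. The difference of two such integers has the shape treated in
  \<open>block_sum_nonzero\<close>.\<close>

lemma measure_stage:
  assumes sat: "\<And>a b. {a..<b} \<inter> Y = {} \<Longrightarrow> {a..<b} \<subseteq> U \<or> {a..<b} \<inter> U = {}"
    and U: "U \<in> sets lebesgue" "U \<subseteq> {- real (Suc n)..<real (Suc n)}"
    and i: "i < k" "i \<notin> stage (Suc n) ` Y"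
  shows "measure lebesgue (stage (Suc n) -` {i} \<inter> U) =
    real_of_int (\<Sum>r<cells n. of_bool (block n r i \<subseteq> U) * (int k + 2) ^ r +
      of_bool (col n (idx n r) = i \<and> rest n r \<subseteq> U) * (int (ratio n) - int k * (int k + 2) ^ r)) /
      real (res (Suc n))"
proof -
  define C where "C r = grid_ivl n (idx n r) (idx n r + 1) \<inter> stage (Suc n) -` {i} \<inter> U" for r
  have "stage (Suc n) -` {i} \<inter> U = (\<Union>r<cells n. C r)"
    using U(2) unfolding cells_cover C_def by blast
  also have "measure lebesgue \<dots> = (\<Sum>r<cells n. measure lebesgue (C r))"
  proof (rule measure_finite_Union)
    have "C r \<in> lmeasurable" for r unfolding C_def using grid_ivl_lmeasurable stage_vimage U(1)
      by (metis Int_assoc fmeasurable_Int_fmeasurable sets.Int)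
    then show "C ` {..<cells n} \<subseteq> sets lebesgue" "\<And>r. emeasure lebesgue (C r) \<noteq> \<infinity>"
      using fmeasurableD fmeasurableD2 by (blast, metis infinity_ennreal_def)
    show "disjoint_family_on C {..<cells n}"
      unfolding disjoint_family_on_def C_def by (auto simp: mem_grid_ivl idx_def)
  qed simp
  also have "\<dots> = (\<Sum>r<cells n. real_of_int (of_bool (block n r i \<subseteq> U) * (int k + 2) ^ r +
      of_bool (col n (idx n r) = i \<and> rest n r \<subseteq> U) * (int (ratio n) - int k * (int k + 2) ^ r)) /
      real (res (Suc n)))"
    unfolding C_def using measure_cell[OF sat U(1) i] by (intro sum.cong) auto
  finally show ?thesis by (simp only: of_int_sum sum_divide_distrib)
qed

section \<open>Convergence of the stages and the error of the limit\<close>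

lemma stage_Suc_outside_zone:
  assumes "x \<notin> zone n"
  shows "stage (Suc n) x = stage n x"
proof -
  let ?v = "\<lfloor>x * real (res (Suc n))\<rfloor>"
  define t where "t = ?v div int (ratio n)"
  define u where "u = ?v mod int (ratio n)"
  have tu: "?v = t * int (ratio n) + u" by (simp add: t_def u_def)
  have "0 \<le> u" using ratio_pos[of n] by (simp add: u_def)
  have t: "t = \<lfloor>x * real (res n)\<rfloor>" unfolding t_def by (rule floor_res_Suc)
  have "\<not> (0 \<le> t + int (Suc n * res n) \<and> t + int (Suc n * res n) < int (cells n) \<and>
      u < int k * (int k + 2) ^ nat (t + int (Suc n * res n)))"
  proof
    assume a: "0 \<le> t + int (Suc n * res n) \<and> t + int (Suc n * res n) < int (cells n) \<and>
      u < int k * (int k + 2) ^ nat (t + int (Suc n * res n))"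
    define r where "r = nat (t + int (Suc n * res n))"
    have "r < cells n" "t = idx n r" using a unfolding r_def idx_def by auto
    moreover have "x \<in> grid_ivl (Suc n) (t * int (ratio n)) (t * int (ratio n) + int k * (int k + 2) ^ r)"
      using a \<open>0 \<le> u\<close> unfolding mem_grid_ivl tu r_def by simp
    ultimately show False using assms unfolding zone_def by blast
  qed
  then show ?thesis unfolding stage_def col.simps Let_def t[symmetric]
    unfolding t_def[symmetric] u_def[symmetric] by (simp only: if_False)
qed

text \<open>From \<open>n\<close> on the stages are constant at \<open>x\<close>, and a constant
  sequence is its own limes inferior.\<close>

lemma limcol_eq_stage:
  assumes "\<And>j. x \<notin> zone (n + j)"
  shows "limcol x = stage n x"
proof -
  have eq: "stage (n + j) x = stage n x" for j
    by (induction j) (use stage_Suc_outside_zone[OF assms] in auto)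
  show ?thesis unfolding limcol_def
  proof (rule Least_equality)
    show "\<forall>m. \<exists>l\<ge>m. stage l x \<le> stage n x" using eq by (metis le_add2 order_refl)
  next
    fix c assume "\<forall>m. \<exists>l\<ge>m. stage l x \<le> c"
    then obtain l where "l \<ge> n" "stage l x \<le> c" by blast
    then show "stage n x \<le> c" using eq[of "l - n"] by simp
  qed
qed

lemma limcol_less: "limcol x < k"
proof -
  have "limcol x \<le> k - 1" unfolding limcol_def
  proof (rule Least_le, intro allI exI conjI)
    fix m show "m \<le> m" "stage m x \<le> k - 1" using stage_less[of m x] by auto
  qed
  then show ?thesis using k by linarith
qed

lemma res_growth: "res n * (k + 2) ^ j \<le> res (n + j)"
proof (induction j)
  case (Suc j)
  have "(k + 2) ^ 1 \<le> ratio (n + j)" unfolding ratio_def by (rule power_increasing) auto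
  then have "res n * (k + 2) ^ j * (k + 2) \<le> res (n + j) * ratio (n + j)" using Suc by (intro mult_mono) auto
  then show ?case by (simp only: add_Suc_right res_Suc power_Suc2 mult.assoc)
qed simp

lemma zone_lmeasurable: "zone n \<in> lmeasurable"
  unfolding zone_def using grid_ivl_lmeasurable by (intro fmeasurable.finite_UN) auto

text \<open>The blocks of all cells together have at most \<open>(k + 2) ^ cells n\<close> fine
  cells, by a geometric sum; the extra factor \<open>k + 2\<close> in \<open>ratio n\<close> gives
  the gain over the coarse width.\<close>

lemma measure_zone_le: "measure lebesgue (zone n) \<le> 1 / (real (res n) * (real k + 2))"
proof -
  have geo: "(\<Sum>r<m. real k * (real k + 2) ^ r) \<le> (real k + 2) ^ m" for m
  proof (induction m)
    case (Suc m)
    then have "(\<Sum>r<Suc m. real k * (real k + 2) ^ r) \<le> (real k + 1) * (real k + 2) ^ m"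
      by (simp add: algebra_simps)
    also have "\<dots> \<le> (real k + 2) * (real k + 2) ^ m" by (intro mult_right_mono) auto
    finally show ?case by simp
  qed simp
  have "measure lebesgue (zone n) \<le> (\<Sum>r<cells n. measure lebesgue
      (grid_ivl (Suc n) (idx n r * int (ratio n)) (idx n r * int (ratio n) + int k * (int k + 2) ^ r)))"
    unfolding zone_def using grid_ivl_lmeasurable by (intro measure_UNION_le) auto
  also have "\<dots> = (\<Sum>r<cells n. real k * (real k + 2) ^ r) / real (res (Suc n))"
    by (simp add: measure_grid_ivl sum_divide_distrib)
  also have "\<dots> \<le> (real k + 2) ^ cells n / real (res (Suc n))"
    by (intro divide_right_mono geo) auto
  also have "\<dots> = 1 / (real (res n) * (real k + 2))"
    unfolding res_Suc ratio_def power_add of_nat_mult of_nat_power of_nat_add of_nat_numeral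
      power_one_right by simp
  finally show ?thesis .
qed

text \<open>Outside this set nothing changes after stage \<open>n\<close>.\<close>

definition late :: "nat \<Rightarrow> real set" where "late n = (\<Union>j. zone (n + j))"

text \<open>The zones shrink at least by the factor \<open>1 / (k + 2)\<close> per stage; summing
  the geometric series turns \<open>k + 2\<close> into \<open>k + 1\<close>.\<close>

lemma late_small: "late n \<in> lmeasurable" "measure lebesgue (late n) \<le> 1 / (real (res n) * (real k + 1))"
proof -
  define c where "c = 1 / (real (res n) * (real k + 2))"
  have c: "c \<ge> 0" by (simp add: c_def)
  have z: "emeasure lebesgue (zone (n + j)) \<le> ennreal (c * (1 / (real k + 2)) ^ j)" for j
  proof -
    have "real (res n) * (real k + 2) ^ j \<le> real (res (n + j))"
      using res_growth[of n j] by (metis of_nat_le_iff of_nat_mult of_nat_power of_nat_add of_nat_numeral)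
    then have "1 / (real (res (n + j)) * (real k + 2)) \<le> 1 / (real (res n) * (real k + 2) ^ j * (real k + 2))"
      using res_pos[of n] by (intro divide_left_mono mult_right_mono mult_pos_pos) (auto simp: res_pos)
    also have "\<dots> = c * (1 / (real k + 2)) ^ j" by (simp add: c_def field_simps)
    finally have "measure lebesgue (zone (n + j)) \<le> c * (1 / (real k + 2)) ^ j"
      using measure_zone_le[of "n + j"] by linarith
    then show ?thesis using zone_lmeasurable[of "n + j"] by (simp add: emeasure_eq_measure2 ennreal_leI)
  qed
  have s: "(\<lambda>j. c * (1 / (real k + 2)) ^ j) sums (c * (1 / (1 - 1 / (real k + 2))))"
    by (intro sums_mult geometric_sums) simp
  have e: "c * (1 / (1 - 1 / (real k + 2))) = 1 / (real (res n) * (real k + 1))"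
  proof -
    have "1 - 1 / (real k + 2) = (real k + 1) / (real k + 2)" by (simp add: field_simps)
    then show ?thesis unfolding c_def by simp
  qed
  have sets: "range (\<lambda>j. zone (n + j)) \<subseteq> sets lebesgue" using zone_lmeasurable by blast
  have "emeasure lebesgue (late n) \<le> (\<Sum>j. emeasure lebesgue (zone (n + j)))"
    unfolding late_def using sets by (rule emeasure_subadditive_countably)
  also have "\<dots> \<le> (\<Sum>j. ennreal (c * (1 / (real k + 2)) ^ j))"
    by (intro suminf_le z) auto
  also have "\<dots> = ennreal (1 / (real (res n) * (real k + 1)))"
    using s c unfolding e by (intro suminf_ennreal_eq) auto
  finally have le: "emeasure lebesgue (late n) \<le> ennreal (1 / (real (res n) * (real k + 1)))" .
  have S: "late n \<in> sets lebesgue" unfolding late_def using sets by blast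
  show "late n \<in> lmeasurable" by (rule fmeasurableI[OF S le_less_trans[OF le]]) simp
  show "measure lebesgue (late n) \<le> 1 / (real (res n) * (real k + 1))"
    using le unfolding measure_def by (intro enn2real_leI) auto
qed

text \<open>The two sets differ only inside \<open>late n\<close>.\<close>

lemma measure_limcol_diff_le:
  assumes "U \<in> lmeasurable"
  shows "\<bar>measure lebesgue (limcol -` {i} \<inter> U) - measure lebesgue (stage n -` {i} \<inter> U)\<bar>
    \<le> 1 / (real (res n) * (real k + 1))"
proof -
  have fm: "limcol -` {i} \<inter> U \<in> lmeasurable" "stage n -` {i} \<inter> U \<in> lmeasurable"
    using assms limcol_vimage stage_vimage by (auto simp: Int_commute intro: fmeasurable_Int_fmeasurable)
  have le: "measure lebesgue S \<le> measure lebesgue T + measure lebesgue (late n)"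
    if "S \<in> lmeasurable" "T \<in> lmeasurable" "S \<subseteq> T \<union> late n" for S T
  proof -
    have "measure lebesgue S \<le> measure lebesgue (T \<union> late n)"
      using that late_small(1) by (intro measure_mono_fmeasurable) auto
    also have "\<dots> \<le> measure lebesgue T + measure lebesgue (late n)"
      using that late_small(1) by (intro measure_Un_le) auto
    finally show ?thesis .
  qed
  have "limcol x = stage n x" if "x \<notin> late n" for x using limcol_eq_stage that unfolding late_def by blast
  then have "limcol -` {i} \<inter> U \<subseteq> stage n -` {i} \<inter> U \<union> late n"
    "stage n -` {i} \<inter> U \<subseteq> limcol -` {i} \<inter> U \<union> late n"
    by auto
  from le[OF fm this(1)] le[OF fm(2,1) this(2)] show ?thesis using late_small(2)[of n] by linarith
qed

section \<open>Separating two disjoint subfamilies by a colour\<close>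

text \<open>Only \<open>A\<close> has to be nonempty, since parts of a fair partition may be
  empty.\<close>

lemma parts_differ:
  assumes F: "interval_family F" and A: "A \<subseteq> F" "A \<noteq> {}" and B: "B \<subseteq> F" and AB: "A \<inter> B = {}"
    and card: "card (endpoints F) \<le> k - 1"
  shows "\<exists>i<k. measure lebesgue (limcol -` {i} \<inter> \<Union>A) \<noteq> measure lebesgue (limcol -` {i} \<inter> \<Union>B)"
proof -
  have finF: "finite F" and ivl: "\<And>I. I \<in> F \<Longrightarrow> \<exists>a b. a < b \<and> I = {a..b}"
    using F unfolding interval_family_def by blast+
  have cpt: "compact (\<Union>G)" if "G \<subseteq> F" for G
  proof (rule compact_Union)
    show "finite G" using that finF by (rule finite_subset)
    show "compact T" if "T \<in> G" for T using ivl[of T] that \<open>G \<subseteq> F\<close> by auto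
  qed
  obtain p q where pq: "p < q" "{p..q} \<in> A" using A ivl by blast
  obtain b where b: "\<And>x. x \<in> \<Union>F \<Longrightarrow> \<bar>x\<bar> \<le> b"
    using compact_imp_bounded[OF cpt[OF order_refl]] unfolding bounded_iff by auto
  \<comment> \<open>The first bound puts the family inside the window of stage \<open>n\<close>; the
    second makes \<open>{p..q}\<close> at least two cells wide, so it contains a whole cell wherever
    the grid lies.\<close>
  obtain n where n: "max b (2 / (q - p)) \<le> real n" using real_arch_simple by blast
  have "n \<le> 2 ^ n" by (rule less_imp_le[OF less_exp])
  also have "(2::nat) ^ n \<le> (k + 2) ^ n" by (intro power_mono) auto
  also have "\<dots> \<le> res n" using res_growth[of 0 n] by simp
  finally have "2 / (q - p) \<le> real (res n)" using n by linarith
  then have gap: "2 \<le> (q - p) * real (res n)" using pq by (simp add: field_simps)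
  have bound: "\<Union>F \<subseteq> {- real (Suc n)..<real (Suc n)}"
  proof
    fix x assume "x \<in> \<Union>F"
    then have "\<bar>x\<bar> \<le> real n" using b n by fastforce
    then show "x \<in> {- real (Suc n)..<real (Suc n)}" by auto
  qed
  \<comment> \<open>Pigeonhole: fewer than \<open>k\<close> endpoints miss some colour.\<close>
  have "card (stage (Suc n) ` endpoints F) < card {..<k}"
    using card_image_le[OF finite_endpoints[OF F], of "stage (Suc n)"] card k by simp
  then have "\<not> {..<k} \<subseteq> stage (Suc n) ` endpoints F"
    using finite_endpoints[OF F] by (meson card_mono finite_imageI linorder_not_less)
  then obtain i where i: "i < k" "i \<notin> stage (Suc n) ` endpoints F" by auto
  define t where "t = \<lceil>p * real (res n)\<rceil>"
  have res_gt0: "real (res n) > 0" using res_pos by simp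
  have t: "p * real (res n) \<le> real_of_int t" "real_of_int t + 1 \<le> q * real (res n)"
    using gap unfolding t_def by (linarith, simp add: algebra_simps, linarith)
  have cell: "grid_ivl n t (t + 1) \<subseteq> {p..q}"
  proof
    fix x assume x: "x \<in> grid_ivl n t (t + 1)"
    have "p \<le> real_of_int t / real (res n)" "real_of_int (t + 1) / real (res n) \<le> q"
      using t res_gt0 by (simp_all add: field_simps)
    then show "x \<in> {p..q}" using x unfolding grid_ivl_def by auto
  qed
  have "real_of_int t / real (res n) \<in> grid_ivl n t (t + 1)"
    using res_gt0 unfolding grid_ivl_def by (simp add: divide_strict_right_mono)
  then have "real_of_int t / real (res n) \<in> {- real (Suc n)..<real (Suc n)}" using cell pq(2) A(1) bound by blast
  then obtain r where r: "r < cells n" "real_of_int t / real (res n) \<in> grid_ivl n (idx n r) (idx n r + 1)"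
    unfolding cells_cover by blast
  then have idx: "idx n r = t" using res_gt0 by (simp add: mem_grid_ivl)
  let ?U = "\<Union>A" and ?V = "\<Union>B"
  have lm: "?U \<in> lmeasurable" "?V \<in> lmeasurable" using cpt A(1) B by (auto intro: lmeasurable_compact)
  define \<sigma> :: "nat \<Rightarrow> int" where "\<sigma> r = of_bool (block n r i \<subseteq> ?U) - of_bool (block n r i \<subseteq> ?V)" for r
  define \<tau> :: "nat \<Rightarrow> int" where "\<tau> r = of_bool (col n (idx n r) = i \<and> rest n r \<subseteq> ?U) -
    of_bool (col n (idx n r) = i \<and> rest n r \<subseteq> ?V)" for r
  define Z where "Z = (\<Sum>r<cells n. \<sigma> r * (int k + 2) ^ r + \<tau> r * (int (ratio n) - int k * (int k + 2) ^ r))"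
  define S where "S G = (\<Sum>r<cells n. of_bool (block n r i \<subseteq> G) * (int k + 2) ^ r +
      of_bool (col n (idx n r) = i \<and> rest n r \<subseteq> G) * (int (ratio n) - int k * (int k + 2) ^ r))" for G
  have "measure lebesgue (stage (Suc n) -` {i} \<inter> \<Union>G) = real_of_int (S (\<Union>G)) / real (res (Suc n))"
    if "G \<subseteq> F" for G
    unfolding S_def
    by (rule measure_stage[where Y = "endpoints F"])
      (use that bound i union_intervals_saturated[OF F that] cpt[OF that] lmeasurable_compact in blast)+
  note S = this[OF A(1)] this[OF B]
  have "Z = S ?U - S ?V"
    unfolding Z_def \<sigma>_def \<tau>_def S_def left_diff_distrib sum.distrib sum_subtractf by linarith
  then have diff: "measure lebesgue (stage (Suc n) -` {i} \<inter> ?U) - measure lebesgue (stage (Suc n) -` {i} \<inter> ?V) =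
      real_of_int Z / real (res (Suc n))"
    unfolding S by (simp only: of_int_diff diff_divide_distrib)
  \<comment> \<open>The cell inside \<open>{p..q}\<close> contributes a nonzero digit: its block of
    colour \<open>i\<close> lies in \<open>?U\<close> and, being free of endpoints, not in
    \<open>?V\<close>.\<close>
  have block: "block n r i \<subseteq> grid_ivl n t (t + 1) \<inter> stage (Suc n) -` {i}"
    using stage_on_cell[OF r(1) i(1)] unfolding idx by blast
  have "block n r i \<subseteq> ?U" using block cell pq(2) by blast
  moreover have "block n r i \<inter> endpoints F = {}" using block i(2) by blast
  then have "\<not> (block n r i \<subseteq> ?U \<and> block n r i \<subseteq> ?V)"
    unfolding grid_ivl_def using res_pos[of "Suc n"]
    by (intro union_intervals_not_both[OF F A(1) B AB] divide_strict_right_mono)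
      (simp_all add: algebra_simps)
  ultimately have "\<sigma> r \<noteq> 0" by (simp add: \<sigma>_def)
  moreover have "(int k + 2) ^ cells n dvd int (ratio n)"
    unfolding ratio_def power_add of_nat_mult of_nat_power of_nat_add of_nat_numeral by (rule dvd_triv_left)
  ultimately have "Z \<noteq> 0" unfolding Z_def using r(1) k
    by (intro block_sum_nonzero) (auto simp: \<sigma>_def \<tau>_def)
  then have "1 \<le> \<bar>real_of_int Z\<bar>" by linarith
  then have "1 / real (res (Suc n)) \<le> \<bar>real_of_int Z / real (res (Suc n))\<bar>"
    by (simp add: divide_right_mono)
  \<comment> \<open>Passing to the limit costs one error for each of the two unions; together they
    stay below one fine width because \<open>k + 1 > 2\<close>.\<close>
  moreover have "2 * (1 / (real (res (Suc n)) * (real k + 1))) < 1 / real (res (Suc n))"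
  proof -
    have "1 / real (res (Suc n)) * (2 / (real k + 1)) < 1 / real (res (Suc n)) * 1"
      using res_pos[of "Suc n"] k by (intro mult_strict_left_mono) auto
    then show ?thesis by simp
  qed
  ultimately have "measure lebesgue (limcol -` {i} \<inter> ?U) \<noteq> measure lebesgue (limcol -` {i} \<inter> ?V)"
    using measure_limcol_diff_le[OF lm(1), of i "Suc n"] measure_limcol_diff_le[OF lm(2), of i "Suc n"] diff by linarith
  then show ?thesis using i(1) by blast
qed

end

theorem theorem3:
  fixes k :: nat
  assumes "k \<ge> 4"
  shows "\<exists>f. measurable_coloring k f \<and>
           \<not> (\<exists>F. interval_family F \<and> F \<noteq> {} \<and> card (endpoints F) \<le> k - 1 \<and>
                (\<exists>q\<ge>2. \<exists>P. fair_partition k f F q P))"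
proof -
  interpret multiscale_coloring k by standard (rule assms)
  \<comment> \<open>\<open>Suc\<close> shifts the colours from \<open>0..k-1\<close> to
    \<open>1..k\<close>.\<close>
  have vim: "(\<lambda>x. Suc (limcol x)) -` {Suc i} = limcol -` {i}" for i by auto
  have "measurable_coloring k (\<lambda>x. Suc (limcol x))"
    unfolding measurable_coloring_def
  proof (intro conjI allI ballI)
    show "Suc (limcol x) \<in> {1..k}" for x using limcol_less[of x] by simp
    show "(\<lambda>x. Suc (limcol x)) -` {i} \<in> sets lebesgue" if "i \<in> {1..k}" for i
      using that limcol_vimage vim by (cases i) auto
  qed
  moreover have False if F: "interval_family F" "F \<noteq> {}" "card (endpoints F) \<le> k - 1"
    and q: "q \<ge> 2" and P: "fair_partition k (\<lambda>x. Suc (limcol x)) F q P" for F q P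
  proof -
    have U: "(\<Union>j\<in>{1..q}. P j) = F" and disj: "disjoint_family_on P {1..q}"
      using P unfolding fair_partition_def by blast+
    obtain j where j: "j \<in> {1..q}" "P j \<noteq> {}" using U F(2) by blast
    obtain l where l: "l \<in> {1..q}" "l \<noteq> j"
      using q that[of 1] that[of 2] by (cases "j = 1") auto
    have "P j \<subseteq> F" "P l \<subseteq> F" "P j \<inter> P l = {}"
      using U disj j l unfolding disjoint_family_on_def by blast+
    then obtain i where i: "i < k"
      "measure lebesgue (limcol -` {i} \<inter> \<Union>(P j)) \<noteq> measure lebesgue (limcol -` {i} \<inter> \<Union>(P l))"
      using parts_differ[OF F(1) _ j(2) _ _ F(3)] by blast
    have "Suc i \<in> {1..k}" using i(1) by auto
    \<comment> \<open>Fairness makes both measures the same fraction \<open>1 / q\<close> of the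
      total.\<close>
    then show False using P i(2) j(1) l(1) vim[of i] unfolding fair_partition_def by metis
  qed
  ultimately show ?thesis by blast
qed

end
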